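(* Let $\langle(X_\alpha,\mu_\alpha)\mid\alpha\in J\rangle$ be an indexed set of normal (respectively, $T_4$) generalized topological spaces. Then their product $\prod_{\alpha\in J}(X_\alpha,\mu_\alpha)$ is also normal (respectively, $T_4$).
   Context: A generalized topology (GT) on a set $X$ (possibly empty) is a family $\mu\subset P(X)$ with $\emptyset\in\mu$ closed under arbitrary unions; $(X,\mu)$ is a generalized topological space (GTS); members of $\mu$ are open, their complements closed. Products are categorical: $\prod_{\alpha\in J}(X_\alpha,\mu_\alpha)$ is the set $\prod_\alpha X_\alpha$ with the GT $\{\bigcup_{\alpha\in J}\pi_\alpha^{-1}(M_\alpha)\mid M_\alpha\in\mu_\alpha\}$, where the $\pi_\alpha$ are the projections; the empty product is a one-point set with GT $\{\emptyset\}$. A GTS is normal if any two disjoint closed sets are contained in disjoint open sets, respectively; it is $T_1$ if for any distinct points $x,y$ there is an open set containing $x$ but not $y$; it is $T_4$ if it is normal and $T_1$. *)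

theory Defs
  imports "HOL-Library.FuncSet"
begin

definition gts :: "'a set \<Rightarrow> 'a set set \<Rightarrow> bool" where
  "gts X \<mu> \<longleftrightarrow> \<mu> \<subseteq> Pow X \<and> {} \<in> \<mu> \<and> (\<forall>\<A>\<subseteq>\<mu>. \<Union>\<A> \<in> \<mu>)"

definition gts_closed :: "'a set \<Rightarrow> 'a set set \<Rightarrow> 'a set \<Rightarrow> bool" where
  "gts_closed X \<mu> C \<longleftrightarrow> (\<exists>U\<in>\<mu>. C = X - U)"

definition normal_gts :: "'a set \<Rightarrow> 'a set set \<Rightarrow> bool" where
  "normal_gts X \<mu> \<longleftrightarrow> gts X \<mu> \<and>
     (\<forall>C D. gts_closed X \<mu> C \<and> gts_closed X \<mu> D \<and> C \<inter> D = {} \<longrightarrow>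
       (\<exists>U\<in>\<mu>. \<exists>V\<in>\<mu>. C \<subseteq> U \<and> D \<subseteq> V \<and> U \<inter> V = {}))"

definition t1_gts :: "'a set \<Rightarrow> 'a set set \<Rightarrow> bool" where
  "t1_gts X \<mu> \<longleftrightarrow> gts X \<mu> \<and>
     (\<forall>x\<in>X. \<forall>y\<in>X. x \<noteq> y \<longrightarrow> (\<exists>U\<in>\<mu>. x \<in> U \<and> y \<notin> U))"

definition t4_gts :: "'a set \<Rightarrow> 'a set set \<Rightarrow> bool" where
  "t4_gts X \<mu> \<longleftrightarrow> normal_gts X \<mu> \<and> t1_gts X \<mu>"

text \<open>
  The open sets of the categorical product on the carrier \<open>Pi\<^sub>E J X\<close>. One open set is taken
  in every factor and the union, not the intersection, of the preimages under the
  projections is formed. For \<open>J = {}\<close> the carrier has exactly one point and the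
  only open set is empty.
\<close>

definition prod_gt :: "'i set \<Rightarrow> ('i \<Rightarrow> 'a set) \<Rightarrow> ('i \<Rightarrow> 'a set set) \<Rightarrow> ('i \<Rightarrow> 'a) set set" where
  "prod_gt J X \<mu> = {(\<Union>\<alpha>\<in>J. {x \<in> Pi\<^sub>E J X. x \<alpha> \<in> M \<alpha>}) | M. \<forall>\<alpha>\<in>J. M \<alpha> \<in> \<mu> \<alpha>}"

end

theory Submission
  imports Defs
begin

text \<open>
  Because the open sets of the product are \<^emph>\<open>unions\<close> of cylinders, one over each index,
  taking complements turns a closed set of the product into a full box of closed sets of the
  factors. Two boxes can only be disjoint if their sides over some single index \<open>\<alpha>\<close> are
  disjoint: otherwise a choice of one common point over every index would lie in both
  boxes. Normality of that one factor separates the two sides, and the cylinders over the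
  separating sets are open in the product, disjoint, and contain the boxes. Likewise, two distinct
  points of the product differ at some index, and a cylinder over that index witnesses the
  \<open>T\<^sub>1\<close> axiom. So separation in the product never involves more than one factor.
\<close>

lemma gts_empty: "gts X \<mu> \<Longrightarrow> {} \<in> \<mu>"
  and gts_Union: "gts X \<mu> \<Longrightarrow> \<A> \<subseteq> \<mu> \<Longrightarrow> \<Union>\<A> \<in> \<mu>"
  by (auto simp: gts_def)

text \<open>Unions over the family and over the indices commute, so a union of open sets is
  described by the union, index by index, of the sets that describe its members.\<close>

lemma gts_prod_gt:
  assumes "\<forall>\<alpha>\<in>J. gts (X \<alpha>) (\<mu> \<alpha>)"
  shows "gts (Pi\<^sub>E J X) (prod_gt J X \<mu>)"
  unfolding gts_def
proof (intro conjI allI impI)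
  show "prod_gt J X \<mu> \<subseteq> Pow (Pi\<^sub>E J X)"
    by (auto simp: prod_gt_def)
  show "{} \<in> prod_gt J X \<mu>"
    unfolding prod_gt_def using assms
    by (intro CollectI exI[of _ "\<lambda>_. {}"]) (auto intro: gts_empty)
next
  fix \<A> assume "\<A> \<subseteq> prod_gt J X \<mu>"
  then have "\<forall>W\<in>\<A>. \<exists>M. W = (\<Union>\<alpha>\<in>J. {x \<in> Pi\<^sub>E J X. x \<alpha> \<in> M \<alpha>}) \<and> (\<forall>\<alpha>\<in>J. M \<alpha> \<in> \<mu> \<alpha>)"
    by (auto simp: prod_gt_def)
  from bchoice[OF this] obtain M
    where M: "\<forall>W\<in>\<A>. W = (\<Union>\<alpha>\<in>J. {x \<in> Pi\<^sub>E J X. x \<alpha> \<in> M W \<alpha>}) \<and> (\<forall>\<alpha>\<in>J. M W \<alpha> \<in> \<mu> \<alpha>)" ..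
  have "\<Union>\<A> = (\<Union>W\<in>\<A>. W)"
    by simp
  also have "\<dots> = (\<Union>W\<in>\<A>. \<Union>\<alpha>\<in>J. {x \<in> Pi\<^sub>E J X. x \<alpha> \<in> M W \<alpha>})"
    by (rule SUP_cong[OF refl]) (rule conjunct1[OF bspec[OF M]])
  also have "\<dots> = (\<Union>\<alpha>\<in>J. {x \<in> Pi\<^sub>E J X. x \<alpha> \<in> (\<Union>W\<in>\<A>. M W \<alpha>)})"
    by auto
  finally have "\<Union>\<A> = (\<Union>\<alpha>\<in>J. {x \<in> Pi\<^sub>E J X. x \<alpha> \<in> (\<Union>W\<in>\<A>. M W \<alpha>)})" .
  moreover have "\<forall>\<alpha>\<in>J. (\<Union>W\<in>\<A>. M W \<alpha>) \<in> \<mu> \<alpha>"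
  proof
    fix \<alpha> assume \<alpha>: "\<alpha> \<in> J"
    have "(\<lambda>W. M W \<alpha>) ` \<A> \<subseteq> \<mu> \<alpha>"
      using conjunct2[OF bspec[OF M]] \<alpha> by blast
    then show "(\<Union>W\<in>\<A>. M W \<alpha>) \<in> \<mu> \<alpha>"
      using assms \<alpha> by (blast intro: gts_Union)
  qed
  ultimately show "\<Union>\<A> \<in> prod_gt J X \<mu>"
    unfolding prod_gt_def by (intro CollectI exI[of _ "\<lambda>\<alpha>. \<Union>W\<in>\<A>. M W \<alpha>"]) simp
qed

text \<open>The union over all indices collapses to one cylinder when every other factor
  contributes its open set \<open>{}\<close>.\<close>

lemma cylinder_in_prod_gt:
  assumes "\<forall>\<beta>\<in>J. gts (X \<beta>) (\<mu> \<beta>)" "\<alpha> \<in> J" "U \<in> \<mu> \<alpha>"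
  shows "{x \<in> Pi\<^sub>E J X. x \<alpha> \<in> U} \<in> prod_gt J X \<mu>"
  unfolding prod_gt_def
  using assms
  by (intro CollectI exI[of _ "\<lambda>\<beta>. if \<beta> = \<alpha> then U else {}"])
     (auto intro: gts_empty split: if_splits)

text \<open>De Morgan: avoiding a union of cylinders means avoiding each of them, that is,
  satisfying an independent closed condition in every coordinate.\<close>

lemma closed_prod_gt_box:
  assumes "gts_closed (Pi\<^sub>E J X) (prod_gt J X \<mu>) C"
  obtains K where "C = Pi\<^sub>E J K" "\<forall>\<alpha>\<in>J. gts_closed (X \<alpha>) (\<mu> \<alpha>) (K \<alpha>)"
proof -
  obtain M where M: "\<forall>\<alpha>\<in>J. M \<alpha> \<in> \<mu> \<alpha>"
    and C: "C = Pi\<^sub>E J X - (\<Union>\<alpha>\<in>J. {x \<in> Pi\<^sub>E J X. x \<alpha> \<in> M \<alpha>})"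
    using assms by (auto simp: gts_closed_def prod_gt_def)
  show thesis
  proof (rule that)
    show "C = Pi\<^sub>E J (\<lambda>\<alpha>. X \<alpha> - M \<alpha>)"
      unfolding C by (auto simp: PiE_iff)
    show "\<forall>\<alpha>\<in>J. gts_closed (X \<alpha>) (\<mu> \<alpha>) (X \<alpha> - M \<alpha>)"
      using M by (auto simp: gts_closed_def)
  qed
qed

lemma normal_prod_gt:
  assumes normal: "\<forall>\<alpha>\<in>J. normal_gts (X \<alpha>) (\<mu> \<alpha>)"
  shows "normal_gts (Pi\<^sub>E J X) (prod_gt J X \<mu>)"
  unfolding normal_gts_def
proof (intro conjI allI impI)
  have gts: "\<forall>\<alpha>\<in>J. gts (X \<alpha>) (\<mu> \<alpha>)"
    using normal by (auto simp: normal_gts_def)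
  then show "gts (Pi\<^sub>E J X) (prod_gt J X \<mu>)"
    by (rule gts_prod_gt)
  fix C D
  assume CD: "gts_closed (Pi\<^sub>E J X) (prod_gt J X \<mu>) C \<and>
    gts_closed (Pi\<^sub>E J X) (prod_gt J X \<mu>) D \<and> C \<inter> D = {}"
  have "gts_closed (Pi\<^sub>E J X) (prod_gt J X \<mu>) C"
    using CD by simp
  then obtain K where K: "C = Pi\<^sub>E J K" "\<forall>\<alpha>\<in>J. gts_closed (X \<alpha>) (\<mu> \<alpha>) (K \<alpha>)"
    by (rule closed_prod_gt_box)
  have "gts_closed (Pi\<^sub>E J X) (prod_gt J X \<mu>) D"
    using CD by simp
  then obtain L where L: "D = Pi\<^sub>E J L" "\<forall>\<alpha>\<in>J. gts_closed (X \<alpha>) (\<mu> \<alpha>) (L \<alpha>)"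
    by (rule closed_prod_gt_box)
  \<comment> \<open>The axiom of choice enters here: a box without an empty side has a point. For an
    empty index set both boxes are the one-point product, hence not disjoint.\<close>
  have "Pi\<^sub>E J (\<lambda>\<alpha>. K \<alpha> \<inter> L \<alpha>) = {}"
    using CD K(1) L(1) by (simp add: PiE_Int)
  then obtain \<alpha> where \<alpha>: "\<alpha> \<in> J" "K \<alpha> \<inter> L \<alpha> = {}"
    by (auto simp: PiE_eq_empty_iff)
  have "normal_gts (X \<alpha>) (\<mu> \<alpha>)"
    using normal \<alpha>(1) by simp
  with bspec[OF K(2) \<alpha>(1)] bspec[OF L(2) \<alpha>(1)] \<alpha>(2)
  have "\<exists>U\<in>\<mu> \<alpha>. \<exists>V\<in>\<mu> \<alpha>. K \<alpha> \<subseteq> U \<and> L \<alpha> \<subseteq> V \<and> U \<inter> V = {}"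
    by (simp add: normal_gts_def)
  then obtain U V where UV: "U \<in> \<mu> \<alpha>" "V \<in> \<mu> \<alpha>" "K \<alpha> \<subseteq> U" "L \<alpha> \<subseteq> V" "U \<inter> V = {}"
    by blast
  have sub: "C \<subseteq> Pi\<^sub>E J X" "D \<subseteq> Pi\<^sub>E J X"
    using CD by (auto simp: gts_closed_def)
  show "\<exists>U\<in>prod_gt J X \<mu>. \<exists>V\<in>prod_gt J X \<mu>. C \<subseteq> U \<and> D \<subseteq> V \<and> U \<inter> V = {}"
  proof (intro bexI conjI)
    show "C \<subseteq> {x \<in> Pi\<^sub>E J X. x \<alpha> \<in> U}" "D \<subseteq> {x \<in> Pi\<^sub>E J X. x \<alpha> \<in> V}"
      using sub K(1) L(1) UV(3,4) \<alpha>(1) by (auto dest: PiE_mem)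
    show "{x \<in> Pi\<^sub>E J X. x \<alpha> \<in> U} \<inter> {x \<in> Pi\<^sub>E J X. x \<alpha> \<in> V} = {}"
      using UV(5) by auto
  qed (use cylinder_in_prod_gt[OF gts \<alpha>(1)] UV(1,2) in auto)
qed

lemma t1_prod_gt:
  assumes t1: "\<forall>\<alpha>\<in>J. t1_gts (X \<alpha>) (\<mu> \<alpha>)"
  shows "t1_gts (Pi\<^sub>E J X) (prod_gt J X \<mu>)"
  unfolding t1_gts_def
proof (intro conjI ballI impI)
  have gts: "\<forall>\<alpha>\<in>J. gts (X \<alpha>) (\<mu> \<alpha>)"
    using t1 by (auto simp: t1_gts_def)
  then show "gts (Pi\<^sub>E J X) (prod_gt J X \<mu>)"
    by (rule gts_prod_gt)
  fix x y assume xy: "x \<in> Pi\<^sub>E J X" "y \<in> Pi\<^sub>E J X" "x \<noteq> y"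
  then obtain \<alpha> where \<alpha>: "\<alpha> \<in> J" "x \<alpha> \<noteq> y \<alpha>"
    by (meson PiE_ext)
  have "t1_gts (X \<alpha>) (\<mu> \<alpha>)" "x \<alpha> \<in> X \<alpha>" "y \<alpha> \<in> X \<alpha>"
    using t1 \<alpha>(1) xy(1,2) by (simp_all add: PiE_mem)
  then obtain U where U: "U \<in> \<mu> \<alpha>" "x \<alpha> \<in> U" "y \<alpha> \<notin> U"
    using \<alpha>(2) by (auto simp: t1_gts_def)
  then show "\<exists>W\<in>prod_gt J X \<mu>. x \<in> W \<and> y \<notin> W"
    using xy(1) by (intro bexI[OF _ cylinder_in_prod_gt[OF gts \<alpha>(1) U(1)]]) simp
qed

theorem proposition4p17:
  fixes J :: "'i set" and X :: "'i \<Rightarrow> 'a set" and \<mu> :: "'i \<Rightarrow> 'a set set"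
  shows "((\<forall>\<alpha>\<in>J. normal_gts (X \<alpha>) (\<mu> \<alpha>)) \<longrightarrow> normal_gts (Pi\<^sub>E J X) (prod_gt J X \<mu>)) \<and>
         ((\<forall>\<alpha>\<in>J. t4_gts (X \<alpha>) (\<mu> \<alpha>)) \<longrightarrow> t4_gts (Pi\<^sub>E J X) (prod_gt J X \<mu>))"
  by (auto simp: t4_gts_def intro: normal_prod_gt t1_prod_gt)

end
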